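(* Let $0<\alpha<1$. Then $H_\alpha^0$ satisfies the $3$-ball property in $H_\alpha^p$: for all $f_1,f_2,f_3\in H_\alpha^0$ with $L(f_i)\le 1$ ($i=1,2,3$), all $h\in H_\alpha^p$ with $L(h)\le1$ and all $\varepsilon>0$ there is some $g\in H_\alpha^0$ satisfying $$L(h+f_i-g)\le 1+\varepsilon\qquad(i=1,2,3).$$
   Context: Scalars are real or complex. For $0<\alpha<1$, $H_\alpha$ is the Banach space of all scalar-valued functions $f$ on $[0,1]$ with $f(0)=0$ and $L(f)=\sup_{x\ne y}\frac{|f(x)-f(y)|}{|x-y|^\alpha}<\infty$, normed by $L(\cdot)$. $H_\alpha^0$ is the closed subspace of all $f\in H_\alpha$ with $\lim_{|x-y|\to 0,\,x\ne y}\frac{|f(x)-f(y)|}{|x-y|^\alpha}=0$ (uniformly). A point $x\in[0,1]$ is a noncritical point of a function $h$ on $[0,1]$ if there is a neighbourhood $U_x$ of $x$ in $[0,1]$ on which $h$ satisfies the uniform lip-condition, i.e. $\lim_{|u-v|\to0,\ u\ne v,\ u,v\in U_x}\frac{|h(u)-h(v)|}{|u-v|^\alpha}=0$; otherwise $x$ is a critical point of $h$. $H_\alpha^p$ is the subspace of all functions in $H_\alpha$ which have (only) finitely many critical points. *)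

theory Defs
  imports "HOL-Analysis.Analysis"
begin

definition holder_quot :: "real \<Rightarrow> (real \<Rightarrow> 'a::real_normed_vector) \<Rightarrow> real \<Rightarrow> real \<Rightarrow> real" where
  "holder_quot \<alpha> f x y = norm (f x - f y) / \<bar>x - y\<bar> powr \<alpha>"

text \<open>The Hoelder constant is extended-real valued, so that it is \<open>\<infinity>\<close> (and not an unspecified
  real supremum) when the quotients are unbounded.\<close>

definition holder_L :: "real \<Rightarrow> (real \<Rightarrow> 'a::real_normed_vector) \<Rightarrow> ereal" where
  "holder_L \<alpha> f =
     (SUP (x, y) \<in> {(x, y). x \<in> {0..1} \<and> y \<in> {0..1} \<and> x \<noteq> y}. ereal (holder_quot \<alpha> f x y))"

text \<open>A function on \<open>[0,1]\<close> is represented by its extension by \<open>0\<close> to the whole real line; this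
  makes the representation unique.\<close>

definition holder_space :: "real \<Rightarrow> (real \<Rightarrow> 'a::real_normed_vector) set" where
  "holder_space \<alpha> = {f. (\<forall>x. x \<notin> {0..1} \<longrightarrow> f x = 0) \<and> f 0 = 0 \<and> holder_L \<alpha> f < \<infinity>}"

text \<open>The filter below describes pairs of points of \<open>U\<close> with \<open>\<bar>u - v\<bar> \<rightarrow> 0\<close> and \<open>u \<noteq> v\<close>.\<close>

definition uniform_lip_on :: "real \<Rightarrow> real set \<Rightarrow> (real \<Rightarrow> 'a::real_normed_vector) \<Rightarrow> bool" where
  "uniform_lip_on \<alpha> U h \<longleftrightarrow>
     ((\<lambda>(u, v). holder_quot \<alpha> h u v) \<longlongrightarrow> 0)
       (inf (filtercomap (\<lambda>(u, v). \<bar>u - v\<bar>) (at_right 0)) (principal (U \<times> U)))"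

lemma uniform_lip_on_iff:
  "uniform_lip_on \<alpha> U h \<longleftrightarrow>
     (\<forall>e>0. \<exists>d>0. \<forall>u\<in>U. \<forall>v\<in>U. u \<noteq> v \<and> \<bar>u - v\<bar> < d \<longrightarrow> holder_quot \<alpha> h u v < e)"
proof -
  have nonneg: "0 \<le> holder_quot \<alpha> h u v" for u v
    by (simp add: holder_quot_def)
  have "eventually (\<lambda>(u, v). holder_quot \<alpha> h u v < e)
          (inf (filtercomap (\<lambda>(u, v). \<bar>u - v\<bar>) (at_right 0)) (principal (U \<times> U))) \<longleftrightarrow>
        (\<exists>d>0. \<forall>u\<in>U. \<forall>v\<in>U. u \<noteq> v \<and> \<bar>u - v\<bar> < d \<longrightarrow> holder_quot \<alpha> h u v < e)" (is "?l \<longleftrightarrow> ?r") for e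
  proof
    assume ?l
    then obtain P where P: "eventually P (at_right (0::real))"
      "\<And>u v. P \<bar>u - v\<bar> \<Longrightarrow> u \<in> U \<Longrightarrow> v \<in> U \<Longrightarrow> holder_quot \<alpha> h u v < e"
      by (auto simp: eventually_inf_principal eventually_filtercomap)
    then show ?r
      unfolding eventually_at_right_field by (metis right_minus_eq zero_less_abs_iff)
  next
    assume ?r
    then obtain d where "d > 0"
      "\<And>u v. u \<in> U \<Longrightarrow> v \<in> U \<Longrightarrow> u \<noteq> v \<Longrightarrow> \<bar>u - v\<bar> < d \<Longrightarrow> holder_quot \<alpha> h u v < e"
      by blast
    then show ?l
      unfolding eventually_inf_principal eventually_filtercomap
      by (intro exI[of _ "\<lambda>r. 0 < r \<and> r < d"])
         (auto simp: eventually_at_right_field)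
  qed
  then show ?thesis
    by (simp add: uniform_lip_on_def tendsto_iff nonneg case_prod_unfold)
qed

definition little_holder_space :: "real \<Rightarrow> (real \<Rightarrow> 'a::real_normed_vector) set" where
  "little_holder_space \<alpha> = {f \<in> holder_space \<alpha>. uniform_lip_on \<alpha> {0..1} f}"

definition noncritical_point :: "real \<Rightarrow> (real \<Rightarrow> 'a::real_normed_vector) \<Rightarrow> real \<Rightarrow> bool" where
  "noncritical_point \<alpha> h x \<longleftrightarrow>
     (\<exists>U \<subseteq> {0..1}. (\<exists>V. openin (top_of_set {0..1}) V \<and> x \<in> V \<and> V \<subseteq> U) \<and> uniform_lip_on \<alpha> U h)"

definition critical_points :: "real \<Rightarrow> (real \<Rightarrow> 'a::real_normed_vector) \<Rightarrow> real set" where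
  "critical_points \<alpha> h = {x \<in> {0..1}. \<not> noncritical_point \<alpha> h x}"

definition holder_p_space :: "real \<Rightarrow> (real \<Rightarrow> 'a::real_normed_vector) set" where
  "holder_p_space \<alpha> = {h \<in> holder_space \<alpha>. finite (critical_points \<alpha> h)}"

definition three_ball_property ::
    "((real \<Rightarrow> 'a::real_normed_vector) \<Rightarrow> ereal) \<Rightarrow> (real \<Rightarrow> 'a) set \<Rightarrow> (real \<Rightarrow> 'a) set \<Rightarrow> bool" where
  "three_ball_property N J X \<longleftrightarrow>
     (\<forall>f1\<in>J. \<forall>f2\<in>J. \<forall>f3\<in>J. \<forall>h\<in>X. \<forall>\<epsilon>::real.
        N f1 \<le> 1 \<longrightarrow> N f2 \<le> 1 \<longrightarrow> N f3 \<le> 1 \<longrightarrow> N h \<le> 1 \<longrightarrow> \<epsilon> > 0 \<longrightarrow>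
        (\<exists>g\<in>J. \<forall>f\<in>{f1, f2, f3}. N (\<lambda>x. h x + f x - g x) \<le> ereal (1 + \<epsilon>)))"

end

theory Submission
  imports Defs
begin

text \<open>
  The idea is to split \<open>h = g + \<phi>\<close> so that \<open>g\<close> is a little Hoelder function while \<open>\<phi>\<close> satisfies
  essentially the same Hoelder bound as \<open>h\<close> and is uniformly as small as desired. Such a \<open>\<phi>\<close> hardly
  interacts with a given little Hoelder function \<open>f\<close>, as the two live on different scales: the
  Hoelder quotients of \<open>f\<close> are negligible over distances below some \<open>\<delta>\<close>, and those of \<open>\<phi>\<close> are
  negligible over distances above \<open>\<delta>\<close> as soon as \<open>2 * sup (norm \<circ> \<phi>)\<close> is small against
  \<open>\<delta> powr \<alpha>\<close>. Writing \<open>L\<close> for the Hoelder constant, this gives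
  \<open>L (\<phi> + f) \<le> max (L h) (L f) + \<epsilon>\<close>, and it works for any finite number of functions \<open>f\<close> at once.

  To find \<open>\<phi>\<close>, let \<open>c\<close> be a Lipschitz function that agrees with \<open>h\<close> at the finitely many
  critical points of \<open>h\<close> and at \<open>0\<close>, and let \<open>P\<close> be the nearest-point projection
  onto the closed ball of radius \<open>\<eta>\<close>. Put \<open>\<phi> = P \<circ> (h - c)\<close> and \<open>g = h - \<phi>\<close>. Near a critical
  point \<open>h - c\<close> is smaller than \<open>\<eta>\<close>, so \<open>P\<close> does nothing and \<open>g = c\<close>; near any other point \<open>h\<close>
  satisfies the lip-condition, hence so do \<open>h - c\<close>, \<open>\<phi>\<close> and \<open>g\<close>, because \<open>P\<close> is nonexpansive. Thus
  \<open>g\<close> has no critical points, and compactness of \<open>[0,1]\<close> (\<open>uniform_lip_on_if_no_critical_points\<close>)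
  puts it into the little Hoelder space. As \<open>c\<close> is Lipschitz and \<open>\<alpha> < 1\<close>, subtracting \<open>c\<close>
  costs arbitrarily little over small distances, which gives the Hoelder bound for \<open>\<phi>\<close> there.

  Only the nearest-point projection uses the structure of the scalars, so that the argument covers
  functions with values in any Euclidean space, in particular real and complex ones.
\<close>

section \<open>Hoelder bounds and the uniform lip-condition\<close>

lemma holder_L_le_iff:
  "holder_L \<alpha> f \<le> ereal C \<longleftrightarrow>
     (\<forall>x\<in>{0..1}. \<forall>y\<in>{0..1}. norm (f x - f y) \<le> C * \<bar>x - y\<bar> powr \<alpha>)"
proof -
  have quot: "holder_quot \<alpha> f x y \<le> C \<longleftrightarrow> norm (f x - f y) \<le> C * \<bar>x - y\<bar> powr \<alpha>" if "x \<noteq> y" for x y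
    using that by (simp add: holder_quot_def pos_divide_le_eq)
  have "holder_L \<alpha> f \<le> ereal C \<longleftrightarrow>
      (\<forall>x y. x \<in> {0..1} \<and> y \<in> {0..1} \<and> x \<noteq> y \<longrightarrow> holder_quot \<alpha> f x y \<le> C)"
    unfolding holder_L_def SUP_le_iff
    by (simp only: Ball_def split_paired_All mem_Collect_eq prod.case ereal_less_eq)
  also have "\<dots> \<longleftrightarrow> (\<forall>x\<in>{0..1}. \<forall>y\<in>{0..1}. norm (f x - f y) \<le> C * \<bar>x - y\<bar> powr \<alpha>)"
  proof (intro iffI ballI allI impI)
    fix x y :: real assume "\<forall>x y. x \<in> {0..1} \<and> y \<in> {0..1} \<and> x \<noteq> y \<longrightarrow> holder_quot \<alpha> f x y \<le> C"
      "x \<in> {0..1}" "y \<in> {0..1}"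
    then show "norm (f x - f y) \<le> C * \<bar>x - y\<bar> powr \<alpha>"
      by (cases "x = y") (simp_all add: quot)
  qed (simp add: quot)
  finally show ?thesis .
qed

lemma holder_L_finiteI:
  assumes "holder_L \<alpha> f \<le> ereal C"
  shows "holder_L \<alpha> f < \<infinity>"
  using assms by (rule le_less_trans) simp

lemma uniform_lip_on_iff_norm:
  "uniform_lip_on \<alpha> U f \<longleftrightarrow>
     (\<forall>e>0. \<exists>d>0. \<forall>u\<in>U. \<forall>v\<in>U. \<bar>u - v\<bar> < d \<longrightarrow> norm (f u - f v) \<le> e * \<bar>u - v\<bar> powr \<alpha>)"
    (is "_ \<longleftrightarrow> ?R")
proof
  assume L: "uniform_lip_on \<alpha> U f"
  show ?R
  proof (intro allI impI)
    fix e :: real assume "e > 0"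
    then obtain d where d: "d > 0"
      "\<And>u v. u \<in> U \<Longrightarrow> v \<in> U \<Longrightarrow> u \<noteq> v \<Longrightarrow> \<bar>u - v\<bar> < d \<Longrightarrow> holder_quot \<alpha> f u v < e"
      using L unfolding uniform_lip_on_iff by meson
    have "norm (f u - f v) \<le> e * \<bar>u - v\<bar> powr \<alpha>" if "u \<in> U" "v \<in> U" "\<bar>u - v\<bar> < d" for u v
    proof (cases "u = v")
      case False
      with d(2)[OF that(1,2) False that(3)] show ?thesis
        by (simp add: holder_quot_def pos_divide_less_eq)
    qed simp
    with d(1) show "\<exists>d>0. \<forall>u\<in>U. \<forall>v\<in>U. \<bar>u - v\<bar> < d \<longrightarrow> norm (f u - f v) \<le> e * \<bar>u - v\<bar> powr \<alpha>"
      by blast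
  qed
next
  assume R: ?R
  show "uniform_lip_on \<alpha> U f"
    unfolding uniform_lip_on_iff
  proof (intro allI impI)
    fix e :: real assume "e > 0"
    then have "e / 2 > 0" by simp
    with R obtain d where d: "d > 0"
      "\<And>u v. u \<in> U \<Longrightarrow> v \<in> U \<Longrightarrow> \<bar>u - v\<bar> < d \<Longrightarrow> norm (f u - f v) \<le> e / 2 * \<bar>u - v\<bar> powr \<alpha>"
      by meson
    have "holder_quot \<alpha> f u v < e" if "u \<in> U" "v \<in> U" "u \<noteq> v" "\<bar>u - v\<bar> < d" for u v
    proof -
      have "holder_quot \<alpha> f u v \<le> e / 2"
        using d(2)[OF that(1,2,4)] that(3) by (simp add: holder_quot_def pos_divide_le_eq)
      with \<open>e > 0\<close> show ?thesis by simp
    qed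
    with d(1) show "\<exists>d>0. \<forall>u\<in>U. \<forall>v\<in>U. u \<noteq> v \<and> \<bar>u - v\<bar> < d \<longrightarrow> holder_quot \<alpha> f u v < e"
      by blast
  qed
qed

lemma uniform_lip_onD:
  assumes "uniform_lip_on \<alpha> U f" "e > 0"
  obtains d where "d > 0"
    "\<And>u v. u \<in> U \<Longrightarrow> v \<in> U \<Longrightarrow> \<bar>u - v\<bar> < d \<Longrightarrow> norm (f u - f v) \<le> e * \<bar>u - v\<bar> powr \<alpha>"
  using assms unfolding uniform_lip_on_iff_norm by meson

lemma uniform_lip_on_subset:
  assumes "uniform_lip_on \<alpha> U f" "V \<subseteq> U"
  shows "uniform_lip_on \<alpha> V f"
  using assms unfolding uniform_lip_on_iff by (meson subsetD)

text \<open>This covers sums and differences of lip functions, and nonexpansive images of lip functions.\<close>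

lemma uniform_lip_on_dominated:
  assumes "uniform_lip_on \<alpha> U f" "uniform_lip_on \<alpha> U g"
    and "\<And>u v. u \<in> U \<Longrightarrow> v \<in> U \<Longrightarrow> norm (k u - k v) \<le> norm (f u - f v) + norm (g u - g v)"
  shows "uniform_lip_on \<alpha> U k"
  unfolding uniform_lip_on_iff_norm
proof (intro allI impI)
  fix e :: real assume "e > 0"
  then have e: "e / 2 > 0" by simp
  obtain d1 where d1: "d1 > 0"
    "\<And>u v. u \<in> U \<Longrightarrow> v \<in> U \<Longrightarrow> \<bar>u - v\<bar> < d1 \<Longrightarrow> norm (f u - f v) \<le> e / 2 * \<bar>u - v\<bar> powr \<alpha>"
    using uniform_lip_onD[OF assms(1) e] by blast
  obtain d2 where d2: "d2 > 0"
    "\<And>u v. u \<in> U \<Longrightarrow> v \<in> U \<Longrightarrow> \<bar>u - v\<bar> < d2 \<Longrightarrow> norm (g u - g v) \<le> e / 2 * \<bar>u - v\<bar> powr \<alpha>"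
    using uniform_lip_onD[OF assms(2) e] by blast
  have "norm (k u - k v) \<le> e * \<bar>u - v\<bar> powr \<alpha>"
    if "u \<in> U" "v \<in> U" "\<bar>u - v\<bar> < min d1 d2" for u v
    using assms(3)[OF that(1,2)] d1(2)[OF that(1,2)] d2(2)[OF that(1,2)] that(3) by simp
  then show "\<exists>d>0. \<forall>u\<in>U. \<forall>v\<in>U. \<bar>u - v\<bar> < d \<longrightarrow> norm (k u - k v) \<le> e * \<bar>u - v\<bar> powr \<alpha>"
    using d1(1) d2(1) by (intro exI[of _ "min d1 d2"]) auto
qed

text \<open>The reason is that \<open>r = r powr (1 - \<alpha>) * r powr \<alpha>\<close>, where the first factor tends to \<open>0\<close> with \<open>r\<close>.\<close>

lemma lipschitz_imp_uniform_lip_on: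
  fixes c :: "real \<Rightarrow> 'a::real_normed_vector"
  assumes "\<alpha> < 1" and lip: "K-lipschitz_on U c"
  shows "uniform_lip_on \<alpha> U c"
  unfolding uniform_lip_on_iff_norm
proof (intro allI impI)
  fix e :: real assume "e > 0"
  have K: "K \<ge> 0" using lip by (rule lipschitz_on_nonneg)
  define d where "d = (e / (K + 1)) powr (1 / (1 - \<alpha>))"
  have "d > 0" using \<open>e > 0\<close> K by (simp add: d_def)
  have "norm (c u - c v) \<le> e * \<bar>u - v\<bar> powr \<alpha>" if uv: "u \<in> U" "v \<in> U" "\<bar>u - v\<bar> < d" for u v
  proof -
    let ?r = "\<bar>u - v\<bar>"
    have "?r powr (1 - \<alpha>) \<le> d powr (1 - \<alpha>)"
      using uv(3) \<open>\<alpha> < 1\<close> by (intro powr_mono2) auto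
    also have "\<dots> = e / (K + 1)"
      using \<open>\<alpha> < 1\<close> \<open>e > 0\<close> K by (simp add: d_def powr_powr)
    finally have small: "(K + 1) * ?r powr (1 - \<alpha>) \<le> e"
      using K by (simp add: pos_le_divide_eq mult.commute)
    have "norm (c u - c v) \<le> K * ?r"
      using lipschitz_onD[OF lip uv(1,2)] by (simp add: dist_norm)
    also have "\<dots> \<le> (K + 1) * ?r" by (simp add: mult_right_mono)
    also have "\<dots> = (K + 1) * ?r powr (1 - \<alpha>) * ?r powr \<alpha>"
      by (cases "?r = 0") (simp_all add: powr_add[symmetric])
    also have "\<dots> \<le> e * ?r powr \<alpha>"
      using small by (rule mult_right_mono) simp
    finally show ?thesis .
  qed
  with \<open>d > 0\<close> show "\<exists>d>0. \<forall>u\<in>U. \<forall>v\<in>U. \<bar>u - v\<bar> < d \<longrightarrow> norm (c u - c v) \<le> e * \<bar>u - v\<bar> powr \<alpha>"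
    by blast
qed

section \<open>Critical points\<close>

lemma noncritical_point_iff_ball:
  assumes "x \<in> {0..1}"
  shows "noncritical_point \<alpha> h x \<longleftrightarrow> (\<exists>r>0. uniform_lip_on \<alpha> ({0..1} \<inter> ball x r) h)"
proof
  assume "noncritical_point \<alpha> h x"
  then obtain U V where "openin (top_of_set {0..1}) V" "x \<in> V" "V \<subseteq> U"
    and U: "uniform_lip_on \<alpha> U h"
    unfolding noncritical_point_def by blast
  then obtain r where "r > 0" "ball x r \<inter> {0..1} \<subseteq> U"
    unfolding openin_contains_ball by (meson order_trans)
  with uniform_lip_on_subset[OF U] show "\<exists>r>0. uniform_lip_on \<alpha> ({0..1} \<inter> ball x r) h"
    by (metis Int_commute)
next
  assume "\<exists>r>0. uniform_lip_on \<alpha> ({0..1} \<inter> ball x r) h"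
  then obtain r where "r > 0" and r: "uniform_lip_on \<alpha> ({0..1} \<inter> ball x r) h"
    by blast
  then show "noncritical_point \<alpha> h x"
    unfolding noncritical_point_def using assms
    by (intro exI[of _ "{0..1} \<inter> ball x r"] conjI) (auto intro: openin_open_Int)
qed

text \<open>
  For a fixed tolerance \<open>e\<close>, the open sets on which all Hoelder quotients are at most \<open>e\<close> cover the
  compact interval, so balls of some fixed radius fit into them.
\<close>

lemma uniform_lip_on_if_no_critical_points:
  assumes nc: "\<And>x. x \<in> {0..1} \<Longrightarrow> noncritical_point \<alpha> h x"
  shows "uniform_lip_on \<alpha> {0..1} h"
  unfolding uniform_lip_on_iff_norm
proof (intro allI impI)
  fix e :: real assume "e > 0"
  define \<G> where "\<G> = {V. open V \<and>
    (\<forall>u\<in>{0..1} \<inter> V. \<forall>v\<in>{0..1} \<inter> V. norm (h u - h v) \<le> e * \<bar>u - v\<bar> powr \<alpha>)}"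
  have "x \<in> \<Union>\<G>" if x: "x \<in> {0..1}" for x
  proof -
    obtain r where "r > 0" and r: "uniform_lip_on \<alpha> ({0..1} \<inter> ball x r) h"
      using nc[OF x] noncritical_point_iff_ball[OF x] by blast
    obtain d where "d > 0" and d: "\<And>u v. u \<in> {0..1} \<inter> ball x r \<Longrightarrow> v \<in> {0..1} \<inter> ball x r \<Longrightarrow>
        \<bar>u - v\<bar> < d \<Longrightarrow> norm (h u - h v) \<le> e * \<bar>u - v\<bar> powr \<alpha>"
      using uniform_lip_onD[OF r \<open>e > 0\<close>] by blast
    have "ball x (min r (d / 2)) \<in> \<G>"
      unfolding \<G>_def
    proof (intro CollectI conjI ballI open_ball)
      fix u v assume uv: "u \<in> {0..1} \<inter> ball x (min r (d / 2))" "v \<in> {0..1} \<inter> ball x (min r (d / 2))"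
      have "dist u v \<le> dist x u + dist x v" by (rule dist_triangle3)
      also have "\<dots> < d" using uv by simp
      finally show "norm (h u - h v) \<le> e * \<bar>u - v\<bar> powr \<alpha>"
        using uv by (intro d) (simp_all add: dist_real_def)
    qed
    moreover have "x \<in> ball x (min r (d / 2))" using \<open>r > 0\<close> \<open>d > 0\<close> by simp
    ultimately show ?thesis by blast
  qed
  then have "{0..1} \<subseteq> \<Union>\<G>" by (rule subsetI)
  moreover have "open V" if "V \<in> \<G>" for V
    using that by (simp add: \<G>_def)
  ultimately obtain d where "d > 0" and d: "\<And>x. x \<in> {0..1} \<Longrightarrow> \<exists>V\<in>\<G>. ball x d \<subseteq> V"
    using Heine_Borel_lemma[OF compact_Icc] by metis
  have "norm (h u - h v) \<le> e * \<bar>u - v\<bar> powr \<alpha>"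
    if uv: "u \<in> {0..1}" "v \<in> {0..1}" "\<bar>u - v\<bar> < d" for u v
  proof -
    obtain V where V: "V \<in> \<G>" "ball u d \<subseteq> V" using d[OF uv(1)] by blast
    moreover have "u \<in> V" "v \<in> V"
      using V(2) uv(3) \<open>d > 0\<close> by (auto simp: dist_real_def subset_iff)
    ultimately show ?thesis using uv by (auto simp: \<G>_def)
  qed
  with \<open>d > 0\<close> show "\<exists>d>0. \<forall>u\<in>{0..1}. \<forall>v\<in>{0..1}. \<bar>u - v\<bar> < d \<longrightarrow>
      norm (h u - h v) \<le> e * \<bar>u - v\<bar> powr \<alpha>"
    by blast
qed

section \<open>Lipschitz interpolation\<close>

text \<open>
  Prescribe the values one point at a time, each time correcting by a multiple of a tent function
  that vanishes at the points treated before.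
\<close>

lemma ex_lipschitz_interpolation:
  fixes h :: "'b::metric_space \<Rightarrow> 'a::real_normed_vector"
  assumes "finite F"
  obtains K c where "K-lipschitz_on UNIV c" "\<And>x. x \<in> F \<Longrightarrow> c x = h x"
proof -
  have "\<exists>K c. K-lipschitz_on UNIV c \<and> (\<forall>x\<in>F. c x = h x)"
    using assms
  proof (induction F)
    case empty
    have "0-lipschitz_on UNIV (\<lambda>_::'b. 0::'a)" by (rule lipschitz_onI) auto
    then show ?case by blast
  next
    case (insert a F)
    then obtain K c where c: "K-lipschitz_on UNIV c" "\<forall>x\<in>F. c x = h x" by blast
    obtain d where "d > 0" and d: "\<And>x. x \<in> F \<Longrightarrow> d \<le> dist a x"
      using finite_set_avoid[OF insert.hyps(1), of a] insert.hyps(2) by metis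
    define t where "t x = max 0 (1 - dist a x / d)" for x
    define w where "w = h a - c a"
    have t: "\<bar>t x - t y\<bar> \<le> dist x y / d" for x y
    proof -
      have "\<bar>t x - t y\<bar> \<le> \<bar>dist a x / d - dist a y / d\<bar>" unfolding t_def by linarith
      also have "\<dots> = \<bar>dist a x - dist a y\<bar> / d"
        using \<open>d > 0\<close> by (simp add: diff_divide_distrib[symmetric])
      also have "\<dots> \<le> dist x y / d"
        using \<open>d > 0\<close> abs_dist_diff_le[of x a y] by (intro divide_right_mono) (auto simp: dist_commute)
      finally show ?thesis .
    qed
    have "(norm w / d)-lipschitz_on UNIV (\<lambda>x. t x *\<^sub>R w)"
    proof (rule lipschitz_onI)
      fix x y
      have "dist (t x *\<^sub>R w) (t y *\<^sub>R w) = \<bar>t x - t y\<bar> * norm w"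
        by (simp add: dist_norm scaleR_left_diff_distrib[symmetric])
      also have "\<dots> \<le> dist x y / d * norm w" using t by (rule mult_right_mono) simp
      finally show "dist (t x *\<^sub>R w) (t y *\<^sub>R w) \<le> norm w / d * dist x y"
        by (simp add: mult.commute)
    qed (use \<open>d > 0\<close> in simp)
    then have "(K + norm w / d)-lipschitz_on UNIV (\<lambda>x. c x + t x *\<^sub>R w)"
      using c(1) by (intro lipschitz_on_add)
    moreover have "c x + t x *\<^sub>R w = h x" if "x \<in> insert a F" for x
    proof (cases "x = a")
      case True
      then show ?thesis using \<open>d > 0\<close> by (simp add: t_def w_def)
    next
      case False
      with that have "x \<in> F" by simp
      with d \<open>d > 0\<close> have "t x = 0" by (simp add: t_def)
      with \<open>x \<in> F\<close> c(2) show ?thesis by simp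
    qed
    ultimately show ?case by blast
  qed
  then show thesis using that by blast
qed

section \<open>Splitting off a uniformly small part\<close>

text \<open>
  \<open>g\<close> is the little Hoelder part of \<open>h\<close>; its remainder \<open>h - g\<close> is uniformly at most \<open>\<eta>\<close>. The
  scale \<open>d\<close> up to which \<open>h - g\<close> almost keeps the Hoelder constant of \<open>h\<close> has to be independent of \<open>\<eta>\<close>,
  since \<open>\<eta>\<close> is going to be chosen small in comparison with \<open>d powr \<alpha>\<close>. It depends only on \<open>\<alpha>\<close>, the
  tolerance \<open>e\<close> and the Lipschitz function \<open>c\<close> that interpolates \<open>h\<close> at its critical points.
\<close>

lemma holder_p_space_split:
  fixes h :: "real \<Rightarrow> 'a::euclidean_space"
  assumes "0 < \<alpha>" "\<alpha> < 1" and h: "h \<in> holder_p_space \<alpha>" "holder_L \<alpha> h \<le> ereal M" and "e > 0"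
  obtains d where "d > 0"
    "\<And>\<eta>. \<eta> > 0 \<Longrightarrow> \<exists>g\<in>little_holder_space \<alpha>. (\<forall>x. norm (h x - g x) \<le> \<eta>) \<and>
       (\<forall>x\<in>{0..1}. \<forall>y\<in>{0..1}. \<bar>x - y\<bar> < d \<longrightarrow>
          norm ((h x - g x) - (h y - g y)) \<le> (M + e) * \<bar>x - y\<bar> powr \<alpha>)"
proof -
  have h_out: "h x = 0" if "x \<notin> {0..1}" for x
    using h(1) that by (simp add: holder_p_space_def holder_space_def)
  have h0: "h 0 = 0" and fin: "finite (critical_points \<alpha> h)"
    using h(1) by (auto simp: holder_p_space_def holder_space_def)
  have hM: "norm (h x - h y) \<le> M * \<bar>x - y\<bar> powr \<alpha>" if "x \<in> {0..1}" "y \<in> {0..1}" for x y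
    using h(2) that unfolding holder_L_le_iff by blast
  from fin have "finite (insert 0 (critical_points \<alpha> h))" by simp
  from ex_lipschitz_interpolation[OF this, of h]
  obtain K c where c: "K-lipschitz_on UNIV c"
      and interp: "\<And>x. x \<in> insert 0 (critical_points \<alpha> h) \<Longrightarrow> c x = h x"
    by blast
  have c0: "c 0 = 0" using interp[of 0] h0 by simp
  have cK: "norm (c x - c y) \<le> K * \<bar>x - y\<bar>" for x y
    using lipschitz_onD[OF c, of x y] by (simp add: dist_norm)
  have c_lip: "uniform_lip_on \<alpha> U c" for U
    by (rule lipschitz_imp_uniform_lip_on[OF \<open>\<alpha> < 1\<close> lipschitz_on_subset[OF c]]) simp
  obtain d where "d > 0" and d: "\<And>x y. x \<in> UNIV \<Longrightarrow> y \<in> UNIV \<Longrightarrow> \<bar>x - y\<bar> < d \<Longrightarrow>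
      norm (c x - c y) \<le> e * \<bar>x - y\<bar> powr \<alpha>"
    using uniform_lip_onD[OF c_lip \<open>e > 0\<close>] by blast
  have "\<exists>g\<in>little_holder_space \<alpha>. (\<forall>x. norm (h x - g x) \<le> \<eta>) \<and>
       (\<forall>x\<in>{0..1}. \<forall>y\<in>{0..1}. \<bar>x - y\<bar> < d \<longrightarrow>
          norm ((h x - g x) - (h y - g y)) \<le> (M + e) * \<bar>x - y\<bar> powr \<alpha>)"
    if "\<eta> > 0" for \<eta>
  proof -
    define P :: "'a \<Rightarrow> 'a" where "P = closest_point (cball 0 \<eta>)"
    have P_bound: "norm (P z) \<le> \<eta>" for z
      using closest_point_in_set[of "cball 0 \<eta>" z] \<open>\<eta> > 0\<close> by (simp add: P_def)
    have P_id: "P z = z" if "norm z \<le> \<eta>" for z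
      using that by (simp add: P_def closest_point_self)
    have P_nonexp: "norm (P y - P z) \<le> norm (y - z)" for y z
      using closest_point_lipschitz[of "cball 0 \<eta>" y z] \<open>\<eta> > 0\<close> by (simp add: P_def dist_norm)
    define \<phi> where "\<phi> x = (if x \<in> {0..1} then P (h x - c x) else 0)" for x
    define g where "g x = h x - \<phi> x" for x
    have \<phi>_bound: "norm (\<phi> x) \<le> \<eta>" for x
      using P_bound \<open>\<eta> > 0\<close> by (simp add: \<phi>_def)
    have \<phi>_diff: "norm (\<phi> x - \<phi> y) \<le> norm (h x - h y) + norm (c x - c y)"
      if "x \<in> {0..1}" "y \<in> {0..1}" for x y
    proof -
      have "norm (\<phi> x - \<phi> y) \<le> norm ((h x - c x) - (h y - c y))"
        using that P_nonexp by (simp add: \<phi>_def)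
      also have "\<dots> = norm ((h x - h y) - (c x - c y))" by (simp add: algebra_simps)
      also have "\<dots> \<le> norm (h x - h y) + norm (c x - c y)" by (rule norm_triangle_ineq4)
      finally show ?thesis .
    qed
    have g_diff: "norm (g x - g y) \<le> norm (h x - h y) + norm (\<phi> x - \<phi> y)" for x y
      using norm_triangle_ineq4[of "h x - h y" "\<phi> x - \<phi> y"] by (simp add: g_def algebra_simps)

    \<comment> \<open>If \<open>x\<close> is noncritical for \<open>h\<close>, the lip-condition passes from \<open>h\<close> to \<open>g\<close>; if \<open>x\<close> is critical,
        \<open>g\<close> coincides near \<open>x\<close> with the Lipschitz function \<open>c\<close>.\<close>
    have "noncritical_point \<alpha> g x" if x: "x \<in> {0..1}" for x
    proof (cases "noncritical_point \<alpha> h x")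
      case True
      then obtain r where "r > 0" and r: "uniform_lip_on \<alpha> ({0..1} \<inter> ball x r) h"
        unfolding noncritical_point_iff_ball[OF x] by blast
      have \<phi>: "uniform_lip_on \<alpha> ({0..1} \<inter> ball x r) \<phi>"
        by (rule uniform_lip_on_dominated[OF r c_lip]) (use \<phi>_diff in auto)
      have "uniform_lip_on \<alpha> ({0..1} \<inter> ball x r) g"
        by (rule uniform_lip_on_dominated[OF r \<phi>]) (use g_diff in auto)
      with \<open>r > 0\<close> show ?thesis unfolding noncritical_point_iff_ball[OF x] by blast
    next
      case False
      with x have cx: "c x = h x" by (intro interp) (simp add: critical_points_def)
      have "((\<lambda>y. M * \<bar>y - x\<bar> powr \<alpha> + K * \<bar>y - x\<bar>) \<longlongrightarrow> M * \<bar>x - x\<bar> powr \<alpha> + K * \<bar>x - x\<bar>) (at x)"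
        using \<open>0 < \<alpha>\<close> by (intro tendsto_intros) auto
      then have "((\<lambda>y. M * \<bar>y - x\<bar> powr \<alpha> + K * \<bar>y - x\<bar>) \<longlongrightarrow> 0) (at x)" by simp
      then have "\<forall>\<^sub>F y in at x. M * \<bar>y - x\<bar> powr \<alpha> + K * \<bar>y - x\<bar> < \<eta>"
        using \<open>\<eta> > 0\<close> by (rule order_tendstoD)
      then obtain r where "r > 0"
        and r: "\<And>y. y \<noteq> x \<Longrightarrow> dist y x < r \<Longrightarrow> M * \<bar>y - x\<bar> powr \<alpha> + K * \<bar>y - x\<bar> < \<eta>"
        unfolding eventually_at by blast
      have g_eq: "g y = c y" if y: "y \<in> {0..1} \<inter> ball x r" for y
      proof -
        have "norm (h y - c y) \<le> \<eta>"
        proof (cases "y = x")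
          case False
          have "norm (h y - c y) = norm ((h y - h x) - (c y - c x))" by (simp add: cx)
          also have "\<dots> \<le> norm (h y - h x) + norm (c y - c x)" by (rule norm_triangle_ineq4)
          also have "\<dots> \<le> M * \<bar>y - x\<bar> powr \<alpha> + K * \<bar>y - x\<bar>"
            using hM[of y x] cK[of y x] x y by (intro add_mono) auto
          also have "\<dots> < \<eta>" using r[OF False] y by (simp add: dist_commute)
          finally show ?thesis by simp
        qed (use cx \<open>\<eta> > 0\<close> in simp)
        with y show ?thesis by (simp add: g_def \<phi>_def P_id)
      qed
      have "uniform_lip_on \<alpha> ({0..1} \<inter> ball x r) g"
        by (rule uniform_lip_on_dominated[OF c_lip c_lip]) (simp add: g_eq)
      with \<open>r > 0\<close> show ?thesis unfolding noncritical_point_iff_ball[OF x] by blast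
    qed
    then have g_lip: "uniform_lip_on \<alpha> {0..1} g"
      by (rule uniform_lip_on_if_no_critical_points)

    have "norm (g x - g y) \<le> (2 * M + K) * \<bar>x - y\<bar> powr \<alpha>" if xy: "x \<in> {0..1}" "y \<in> {0..1}" for x y
    proof -
      have "\<bar>x - y\<bar> powr 1 \<le> \<bar>x - y\<bar> powr \<alpha>"
        using xy \<open>\<alpha> < 1\<close> by (intro powr_mono') auto
      then have "K * \<bar>x - y\<bar> \<le> K * \<bar>x - y\<bar> powr \<alpha>"
        using lipschitz_on_nonneg[OF c] by (simp add: mult_left_mono)
      with g_diff[of x y] \<phi>_diff[OF xy] hM[OF xy] cK[of x y] show ?thesis
        by (simp add: algebra_simps)
    qed
    then have "holder_L \<alpha> g < \<infinity>"
      by (intro holder_L_finiteI[of _ _ "2 * M + K"]) (simp add: holder_L_le_iff)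
    moreover have "g x = 0" if "x \<notin> {0..1}" for x
      using that h_out by (auto simp: g_def \<phi>_def)
    moreover have "g 0 = 0"
      using \<open>\<eta> > 0\<close> by (simp add: g_def \<phi>_def h0 c0 P_id)
    ultimately have g_mem: "g \<in> little_holder_space \<alpha>"
      using g_lip by (auto simp: little_holder_space_def holder_space_def)
    have g_local: "norm ((h x - g x) - (h y - g y)) \<le> (M + e) * \<bar>x - y\<bar> powr \<alpha>"
      if "x \<in> {0..1}" "y \<in> {0..1}" "\<bar>x - y\<bar> < d" for x y
      using \<phi>_diff[OF that(1,2)] hM[OF that(1,2)] d[OF UNIV_I UNIV_I that(3)]
      by (simp add: g_def algebra_simps)
    have g_small: "norm (h x - g x) \<le> \<eta>" for x
      using \<phi>_bound by (simp add: g_def)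
    show ?thesis
      by (intro bexI[OF _ g_mem] conjI allI ballI impI g_small g_local)
  qed
  from that[OF \<open>d > 0\<close> this] show thesis .
qed

section \<open>The ball property\<close>

text \<open>
  The little Hoelder functions in \<open>F\<close> act on distances above \<open>d\<close>, and the remainder \<open>h - g\<close> acts on
  distances below \<open>d\<close>, so that the two Hoelder constants do not add up. As \<open>F\<close> is finite, one scale \<open>d\<close>
  serves all of its elements.
\<close>

lemma little_holder_finite_ball_property:
  fixes h :: "real \<Rightarrow> 'a::euclidean_space"
  assumes "0 < \<alpha>" "\<alpha> < 1" and h: "h \<in> holder_p_space \<alpha>" "holder_L \<alpha> h \<le> 1"
    and "finite F" and F: "\<And>f. f \<in> F \<Longrightarrow> f \<in> little_holder_space \<alpha>" "\<And>f. f \<in> F \<Longrightarrow> holder_L \<alpha> f \<le> 1"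
    and "\<epsilon> > 0"
  shows "\<exists>g\<in>little_holder_space \<alpha>. \<forall>f\<in>F. holder_L \<alpha> (\<lambda>x. h x + f x - g x) \<le> ereal (1 + \<epsilon>)"
proof -
  have e: "\<epsilon> / 2 > 0" using \<open>\<epsilon> > 0\<close> by simp
  have fine: "\<exists>d>0. \<forall>x\<in>{0..1}. \<forall>y\<in>{0..1}. \<bar>x - y\<bar> < d \<longrightarrow> norm (f x - f y) \<le> \<epsilon> / 2 * \<bar>x - y\<bar> powr \<alpha>"
    if "f \<in> F" for f
    using F(1)[OF that] e unfolding little_holder_space_def uniform_lip_on_iff_norm by blast
  obtain d1 where d1: "\<And>f. f \<in> F \<Longrightarrow> d1 f > 0" "\<And>f x y. f \<in> F \<Longrightarrow> x \<in> {0..1} \<Longrightarrow> y \<in> {0..1} \<Longrightarrow>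
      \<bar>x - y\<bar> < d1 f \<Longrightarrow> norm (f x - f y) \<le> \<epsilon> / 2 * \<bar>x - y\<bar> powr \<alpha>"
    using fine by metis
  from h(2) have "holder_L \<alpha> h \<le> ereal 1" by (simp add: one_ereal_def)
  from holder_p_space_split[OF assms(1,2) h(1) this e]
  obtain d2 where "d2 > 0" and d2: "\<And>\<eta>. \<eta> > 0 \<Longrightarrow>
     \<exists>g\<in>little_holder_space \<alpha>. (\<forall>x. norm (h x - g x) \<le> \<eta>) \<and>
       (\<forall>x\<in>{0..1}. \<forall>y\<in>{0..1}. \<bar>x - y\<bar> < d2 \<longrightarrow>
          norm ((h x - g x) - (h y - g y)) \<le> (1 + \<epsilon> / 2) * \<bar>x - y\<bar> powr \<alpha>)"
    by blast
  define d where "d = Min (insert d2 (d1 ` F))"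
  have "d > 0" and d_le: "d \<le> d2" "\<And>f. f \<in> F \<Longrightarrow> d \<le> d1 f"
    using \<open>finite F\<close> d1(1) \<open>d2 > 0\<close> by (auto simp: d_def)
  \<comment> \<open>Two values of \<open>h - g\<close> then differ by at most \<open>2 * \<eta> = \<epsilon> * d powr \<alpha>\<close>, which is negligible at
      distances \<open>\<ge> d\<close>.\<close>
  define \<eta> where "\<eta> = \<epsilon> / 2 * d powr \<alpha>"
  have "\<eta> > 0" using \<open>d > 0\<close> \<open>\<epsilon> > 0\<close> by (simp add: \<eta>_def)
  then obtain g where g: "g \<in> little_holder_space \<alpha>" and small: "\<And>x. norm (h x - g x) \<le> \<eta>"
    and local: "\<And>x y. x \<in> {0..1} \<Longrightarrow> y \<in> {0..1} \<Longrightarrow> \<bar>x - y\<bar> < d2 \<Longrightarrow>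
          norm ((h x - g x) - (h y - g y)) \<le> (1 + \<epsilon> / 2) * \<bar>x - y\<bar> powr \<alpha>"
    using d2 by meson
  have bound: "norm ((h x + f x - g x) - (h y + f y - g y)) \<le> (1 + \<epsilon>) * \<bar>x - y\<bar> powr \<alpha>"
    if f: "f \<in> F" and xy: "x \<in> {0..1}" "y \<in> {0..1}" for f x y
  proof -
    let ?r = "\<bar>x - y\<bar> powr \<alpha>"
    have split: "norm ((h x + f x - g x) - (h y + f y - g y))
        \<le> norm ((h x - g x) - (h y - g y)) + norm (f x - f y)"
      using norm_triangle_ineq[of "(h x - g x) - (h y - g y)" "f x - f y"]
      by (simp add: algebra_simps)
    show ?thesis
    proof (cases "\<bar>x - y\<bar> < d")
      case True
      then have "norm ((h x - g x) - (h y - g y)) \<le> (1 + \<epsilon> / 2) * ?r"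
        using xy d_le(1) by (intro local) auto
      moreover have "norm (f x - f y) \<le> \<epsilon> / 2 * ?r"
        using True f xy d_le(2)[OF f] by (intro d1(2)) auto
      ultimately show ?thesis using split by (simp add: algebra_simps)
    next
      case False
      have "norm ((h x - g x) - (h y - g y)) \<le> \<eta> + \<eta>"
        using norm_triangle_ineq4[of "h x - g x" "h y - g y"] small[of x] small[of y] by linarith
      also have "\<dots> = \<epsilon> * d powr \<alpha>" by (simp add: \<eta>_def)
      also have "\<dots> \<le> \<epsilon> * ?r"
        using False \<open>d > 0\<close> \<open>\<epsilon> > 0\<close> \<open>0 < \<alpha>\<close> by (intro mult_left_mono powr_mono2) auto
      finally have "norm ((h x - g x) - (h y - g y)) \<le> \<epsilon> * ?r" .
      moreover have "norm (f x - f y) \<le> ?r"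
        using F(2)[OF f] xy holder_L_le_iff[of \<alpha> f 1] by (simp add: one_ereal_def)
      ultimately show ?thesis using split by (simp add: algebra_simps)
    qed
  qed
  show ?thesis
    by (intro bexI[OF _ g] ballI) (simp only: holder_L_le_iff, intro ballI bound)
qed

lemma little_holder_three_ball_property:
  assumes "0 < \<alpha>" "\<alpha> < 1"
  shows "three_ball_property (holder_L \<alpha>)
           (little_holder_space \<alpha> :: (real \<Rightarrow> 'a::euclidean_space) set) (holder_p_space \<alpha>)"
  unfolding three_ball_property_def
  by (intro ballI allI impI little_holder_finite_ball_property[OF assms]) auto

theorem proposition2p10:
  fixes \<alpha> :: real
  assumes "0 < \<alpha>" and "\<alpha> < 1"
  shows "three_ball_property (holder_L \<alpha>)
           (little_holder_space \<alpha> :: (real \<Rightarrow> real) set) (holder_p_space \<alpha>) \<and>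
         three_ball_property (holder_L \<alpha>)
           (little_holder_space \<alpha> :: (real \<Rightarrow> complex) set) (holder_p_space \<alpha>)"
  using assms by (intro conjI little_holder_three_ball_property)

end
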